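(* Let $\mathcal{X},\mathcal{Y}$ be Euclidean spaces, let $f,g\in\Gamma_0(\mathcal{X})$, $h\in\Gamma_0(\mathcal{Y})$, let $D:\mathcal{X}\to\mathcal{Y}$ be an injective linear operator, and let $\beta\in(0,+\infty)$. Assume that $f$ is differentiable on $\mathcal{X}$ with $1/\beta$-Lipschitz continuous gradient, that the infimum of $$\min_{x\in\mathcal{X}} f(x)+g(x)+(h\circ D)(x)$$ is attained, and that $0\in \mathrm{ri}(\mathrm{dom}\,h-D\,\mathrm{dom}\,g)$. Suppose $0<\gamma<2\beta$ and $0<\lambda\le 1/(\lambda_{\max}(DD^{T})+1)$. Let $x^0,y^0\in\mathcal{X}$ and $v^0\in\mathcal{Y}$ be arbitrary and let $(v^k,y^k,x^k)_{k\ge 0}$ be the sequence generated by the SPDFP$^2$O iteration: for $k\ge 0$, $$ \begin{aligned} x^{k+\frac12}&=x^{k}-\gamma\nabla f(x^{k}),\\ v^{k+1}&=(I-\mathrm{prox}_{\frac{\gamma}{\lambda}h})\big(Dx^{k+\frac12}+(I-\lambda DD^{T})v^{k}-\lambda Dy^{k}\big),\\ y^{k+1}&=(I-\mathrm{prox}_{\frac{\gamma}{\lambda}g})\big(x^{k+\frac12}+(1-\lambda)y^{k}-\lambda D^{T}v^{k}\big),\\ x^{k+1}&=x^{k+\frac12}-\lambda D^{T}v^{k+1}-\lambda y^{k+1}. \end{aligned} $$ Then the sequence $(x^k)$ converges to a solution of $\min_{x\in\mathcal{X}} f(x)+g(x)+(h\circ D)(x)$.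
   Context: For a Euclidean space $\mathcal{H}$, $\Gamma_0(\mathcal{H})$ denotes the set of proper lower semicontinuous convex functions $\mathcal{H}\to(-\infty,+\infty]$. For $\varphi\in\Gamma_0(\mathcal{H})$, $\mathrm{prox}_\varphi(x)=\arg\min_{y\in\mathcal{H}}\ \varphi(y)+\frac12\|x-y\|^2$. $I$ is the identity operator, $D^T$ is the adjoint of $D$, $\lambda_{\max}(DD^T)$ is the largest eigenvalue of $DD^T$, $\mathrm{ri}$ denotes relative interior, and $\mathrm{dom}$ the effective domain. *)

theory Defs
  imports "HOL-Analysis.Analysis"
begin

definition effective_domain :: "('a \<Rightarrow> ereal) \<Rightarrow> 'a set" where
  "effective_domain \<phi> = {x. \<phi> x < \<infinity>}"

text \<open>Functions into \<open>(-\<infinity>, \<infinity>]\<close> are rendered as \<open>ereal\<close>-valued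
  functions that avoid \<open>-\<infinity>\<close>.\<close>

definition proper :: "('a \<Rightarrow> ereal) \<Rightarrow> bool" where
  "proper \<phi> \<longleftrightarrow> (\<forall>x. \<phi> x \<noteq> -\<infinity>) \<and> effective_domain \<phi> \<noteq> {}"

definition lower_semicontinuous :: "('a::topological_space \<Rightarrow> ereal) \<Rightarrow> bool" where
  "lower_semicontinuous \<phi> \<longleftrightarrow> (\<forall>x. \<phi> x \<le> Liminf (at x) \<phi>)"

text \<open>Restricting \<open>t\<close> to the open interval avoids the convention \<open>0 * \<infinity> = 0\<close>
  (the inequality is trivial at \<open>t = 0\<close> and \<open>t = 1\<close>), and for functions that avoid
  \<open>-\<infinity>\<close> the sum on the right never has the form \<open>\<infinity> - \<infinity>\<close>.\<close>

definition ereal_convex :: "('a::real_vector \<Rightarrow> ereal) \<Rightarrow> bool" where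
  "ereal_convex \<phi> \<longleftrightarrow> (\<forall>x y. \<forall>t\<in>{0<..<1}.
     \<phi> ((1 - t) *\<^sub>R x + t *\<^sub>R y) \<le> ereal (1 - t) * \<phi> x + ereal t * \<phi> y)"

definition Gamma0 :: "('a::euclidean_space \<Rightarrow> ereal) set" where
  "Gamma0 = {\<phi>. proper \<phi> \<and> lower_semicontinuous \<phi> \<and> ereal_convex \<phi>}"

text \<open>The minimizer exists and is unique for \<open>\<phi> \<in> Gamma0\<close>; outside of
  \<open>Gamma0\<close> the value of \<open>prox\<close> is an arbitrary choice.\<close>

definition prox :: "('a::euclidean_space \<Rightarrow> ereal) \<Rightarrow> 'a \<Rightarrow> 'a" where
  "prox \<phi> x = (ARG_MIN (\<lambda>y. \<phi> y + ereal (1/2 * (norm (x - y))\<^sup>2)) y. True)"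

definition eigenvalues :: "('a::real_vector \<Rightarrow> 'a) \<Rightarrow> real set" where
  "eigenvalues T = {\<mu>. \<exists>v. v \<noteq> 0 \<and> T v = \<mu> *\<^sub>R v}"

text \<open>Meaningful when \<open>eigenvalues T\<close> is finite and nonempty, in particular for a
  self-adjoint linear operator \<open>T\<close> on a Euclidean space.\<close>

definition lambda_max :: "('a::euclidean_space \<Rightarrow> 'a) \<Rightarrow> real" where
  "lambda_max T = Max (eigenvalues T)"

end

theory Submission
  imports Defs
begin

text \<open>
  With \<open>z = (v, y)\<close>, \<open>B u = (D u, u)\<close> and \<open>Q = (I - prox\<^bsub>(\<gamma>/\<lambda>)h\<^esub>, I - prox\<^bsub>(\<gamma>/\<lambda>)g\<^esub>)\<close> the iteration reads
  \<open>z' = Q (B (x - \<gamma> \<nabla>f x) + z - \<lambda> B B\<^sup>T z)\<close>, \<open>x' = x - \<gamma> \<nabla>f x - \<lambda> B\<^sup>T z'\<close>. Its fixed points \<open>(x, z)\<close>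
  are the solutions \<open>x\<close> paired with \<open>\<gamma>/\<lambda>\<close> times subgradients \<open>p\<close> of \<open>h\<close> at \<open>D x\<close> and \<open>q\<close> of \<open>g\<close> at \<open>x\<close>
  with \<open>\<nabla>f x + D\<^sup>T p + q = 0\<close>. The qualification condition provides such subgradients at every
  minimizer, by separating a convex set of values from the origin.

  Since \<open>Q\<close> is firmly nonexpansive and \<open>\<nabla>f\<close> is \<open>\<beta>\<close>-cocoercive (Baillon-Haddad), the distance
  \<open>(norm (x - x*))\<^sup>2 + \<lambda> (norm (z - z*))\<^sup>2\<close> to any fixed point decreases, and the decrease controls
  \<open>\<nabla>f x - \<nabla>f x*\<close>, \<open>B\<^sup>T (z - z*)\<close> and the seminorm of \<open>z' - z\<close> induced by \<open>I - \<lambda> B B\<^sup>T\<close>; this operator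
  is positive semidefinite because \<open>\<lambda> (\<lambda>\<^sub>m\<^sub>a\<^sub>x(D D\<^sup>T) + 1) \<le> 1\<close>. These quantities therefore tend to zero,
  every cluster point of the iterates is a fixed point, and monotonicity of the distance to a cluster
  point gives convergence of the whole sequence.
\<close>

section \<open>Finite values and convexity of functions in \<open>Gamma0\<close>\<close>

text \<open>Let \<open>t\<close> tend to 0 from the right. This drops second-order terms after a
  division by \<open>t\<close>, and turns strict epigraph bounds into weak ones.\<close>

lemma nonneg_if_affine_nonneg:
  fixes a b :: real
  assumes "\<And>t. 0 < t \<Longrightarrow> t < 1 \<Longrightarrow> 0 \<le> a + t * b"
  shows "0 \<le> a"
proof (rule tendsto_lowerbound)
  show "((\<lambda>t. a + t * b) \<longlongrightarrow> a) (at_right 0)"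
    by (auto intro!: tendsto_eq_intros)
  show "\<forall>\<^sub>F t in at_right 0. 0 \<le> a + t * b"
    using assms by (auto simp: eventually_at_right[of 0 1] intro!: exI[of _ 1])
qed simp

lemma Gamma0_not_MInf: "\<phi> \<in> Gamma0 \<Longrightarrow> \<phi> u \<noteq> -\<infinity>"
  by (simp add: Gamma0_def proper_def)

lemma Gamma0_dom_cases:
  assumes "\<phi> \<in> Gamma0"
  obtains "\<phi> u = \<infinity>" | a where "\<phi> u = ereal a"
  using Gamma0_not_MInf[OF assms, of u] by (cases "\<phi> u") auto

lemma Gamma0_finite_point:
  assumes "\<phi> \<in> Gamma0"
  obtains u a where "\<phi> u = ereal a"
proof -
  obtain u where "\<phi> u < \<infinity>"
    using assms by (auto simp: Gamma0_def proper_def effective_domain_def)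
  then show ?thesis
    using that Gamma0_not_MInf[OF assms, of u] by (cases "\<phi> u") auto
qed

lemma Gamma0_convex_le:
  assumes "\<phi> \<in> Gamma0" "\<phi> u = ereal a" "\<phi> w = ereal b" "0 < t" "t < 1"
  shows "\<phi> (u + t *\<^sub>R (w - u)) \<le> ereal (a + t * (b - a))"
proof -
  have "\<phi> ((1 - t) *\<^sub>R u + t *\<^sub>R w) \<le> ereal (1 - t) * \<phi> u + ereal t * \<phi> w"
    using assms(1,4,5) by (simp add: Gamma0_def ereal_convex_def)
  moreover have "(1 - t) *\<^sub>R u + t *\<^sub>R w = u + t *\<^sub>R (w - u)"
    by (simp add: algebra_simps)
  moreover have "ereal (1 - t) * \<phi> u + ereal t * \<phi> w = ereal (a + t * (b - a))"
    using assms by (simp add: algebra_simps)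
  ultimately show ?thesis by simp
qed

lemma Gamma0_convex_finite:
  assumes "\<phi> \<in> Gamma0" "\<phi> u = ereal a" "\<phi> w = ereal b" "0 < t" "t < 1"
  obtains c where "\<phi> (u + t *\<^sub>R (w - u)) = ereal c" "c \<le> a + t * (b - a)"
  using Gamma0_convex_le[OF assms] that
  by (cases rule: Gamma0_dom_cases[OF assms(1), of "u + t *\<^sub>R (w - u)"]) auto

section \<open>Lower semicontinuity and existence of proximal points\<close>

text \<open>The \<open>Liminf\<close> in \<open>lower_semicontinuous\<close> ignores the point
  itself, but that point satisfies the strict inequality already, so a full neighbourhood does.
  Compactness arguments use lower semicontinuity in this form.\<close>

lemma Gamma0_open_superlevel:
  assumes "\<phi> \<in> Gamma0"
  shows "open {u. c < \<phi> u}"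
proof (subst open_subopen, intro ballI)
  fix u assume "u \<in> {u. c < \<phi> u}"
  then have u: "c < \<phi> u" by simp
  have "\<phi> u \<le> Liminf (at u) \<phi>"
    using assms by (auto simp: Gamma0_def lower_semicontinuous_def)
  then have "\<forall>\<^sub>F w in at u. c < \<phi> w"
    using u less_LiminfD less_le_trans by blast
  then obtain S where "open S" "u \<in> S" "\<forall>w\<in>S. w \<noteq> u \<longrightarrow> c < \<phi> w"
    unfolding eventually_at_topological by blast
  then show "\<exists>T. open T \<and> u \<in> T \<and> T \<subseteq> {u. c < \<phi> u}"
    using u by (intro exI[of _ S]) auto
qed

text \<open>Weierstrass for lower semicontinuous functions: without a minimizer the sets
  \<open>{u. \<psi> w < \<psi> u}\<close> cover \<open>S\<close>, and a minimizer among the indices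
  of a finite subcover lies in none of its members.\<close>

lemma attains_inf_if_open_superlevels:
  fixes \<psi> :: "'a::topological_space \<Rightarrow> ereal"
  assumes "compact S" "S \<noteq> {}" "\<And>c. open {u. c < \<psi> u}"
  obtains u where "u \<in> S" "\<And>w. w \<in> S \<Longrightarrow> \<psi> u \<le> \<psi> w"
proof (rule ccontr)
  assume contra: "\<not> thesis"
  have "S \<subseteq> (\<Union>w\<in>S. {u. \<psi> w < \<psi> u})"
    using contra that by (auto simp: not_le[symmetric])
  then obtain F where F: "F \<subseteq> S" "finite F" "S \<subseteq> (\<Union>w\<in>F. {u. \<psi> w < \<psi> u})"
    using compactE_image[OF assms(1), of S "\<lambda>w. {u. \<psi> w < \<psi> u}"] assms(3) by metis
  have "F \<noteq> {}" using F assms(2) by auto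
  then obtain u where u: "u \<in> F" "\<And>w. w \<in> F \<Longrightarrow> \<psi> u \<le> \<psi> w"
    using F(2) by (metis arg_min_if_finite(1) arg_min_least)
  then obtain w where "w \<in> F" "\<psi> w < \<psi> u" using F by blast
  then show False using u(2) by (simp add: leD)
qed

lemma Gamma0_add_continuous_open_superlevel:
  fixes \<phi> :: "'a::euclidean_space \<Rightarrow> ereal"
  assumes "\<phi> \<in> Gamma0" "continuous_on UNIV q"
  shows "open {u. c < \<phi> u + ereal (q u)}"
proof -
  \<comment> \<open>A real threshold \<open>r\<close> splits the bound between the two summands,
    which leaves a union of open sets.\<close>
  have "{u. c < \<phi> u + ereal (q u)} = (\<Union>r::real. {u. c - ereal r < \<phi> u} \<inter> {u. r < q u})"
  proof (intro set_eqI iffI)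
    fix u assume "u \<in> {u. c < \<phi> u + ereal (q u)}"
    then have "c - ereal (q u) < \<phi> u"
      by (simp add: ereal_minus_less)
    then have "\<exists>r. r < q u \<and> c - ereal r < \<phi> u"
    proof (cases c; cases "\<phi> u"; simp)
      fix a b :: real assume "a - q u < b"
      then show "\<exists>r. r < q u \<and> a - r < b"
        \<comment> \<open>The midpoint of the admissible interval from \<open>a - b\<close> to
          \<open>q u\<close>.\<close>
        by (intro exI[of _ "(q u + (a - b)) / 2"]) (auto simp: field_simps)
    qed (use lt_ex in auto)
    then show "u \<in> (\<Union>r::real. {u. c - ereal r < \<phi> u} \<inter> {u. r < q u})" by auto
  next
    fix u assume "u \<in> (\<Union>r::real. {u. c - ereal r < \<phi> u} \<inter> {u. r < q u})"
    then obtain r where r: "c - ereal r < \<phi> u" "r < q u" by auto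
    have "\<phi> u \<noteq> -\<infinity>" using assms(1) by (rule Gamma0_not_MInf)
    then show "u \<in> {u. c < \<phi> u + ereal (q u)}"
      using r by (cases c; cases "\<phi> u"; simp)
  qed
  then show ?thesis
    using Gamma0_open_superlevel[OF assms(1)] assms(2)
    by (simp add: open_UN open_Int open_Collect_less continuous_on_const)
qed

text \<open>With \<open>m\<close> the minimum over the unit ball around \<open>u\<close>, the point
  at distance 1 on the segment from \<open>u\<close> to \<open>w\<close> has value at least
  \<open>m\<close>; convexity propagates this outward with slope \<open>a - m\<close>. The bound
  makes the proximal objective coercive.\<close>

lemma Gamma0_linear_lower_bound:
  fixes \<phi> :: "'a::euclidean_space \<Rightarrow> ereal"
  assumes "\<phi> \<in> Gamma0" "\<phi> u = ereal a"
  obtains c where "0 \<le> c" "\<And>w. norm (w - u) \<ge> 1 \<Longrightarrow> ereal (a - c * norm (w - u)) \<le> \<phi> w"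
proof -
  obtain m0 where m0: "\<And>w. w \<in> cball u 1 \<Longrightarrow> \<phi> m0 \<le> \<phi> w"
    using attains_inf_if_open_superlevels[of "cball u 1" \<phi>] Gamma0_open_superlevel[OF assms(1)]
    by (metis compact_cball cball_eq_empty less_numeral_extra(1) not_less_iff_gr_or_eq)
  have "\<phi> m0 \<le> ereal a" using m0[of u] assms(2) by simp
  then obtain m where m: "\<phi> m0 = ereal m" "m \<le> a"
    using Gamma0_not_MInf[OF assms(1), of m0] by (cases "\<phi> m0") auto
  show thesis
  proof (rule that[of "a - m"])
    fix w assume w: "1 \<le> norm (w - u)"
    show "ereal (a - (a - m) * norm (w - u)) \<le> \<phi> w"
    proof (cases rule: Gamma0_dom_cases[OF assms(1), of w])
      case (2 b)
      define n where "n = norm (w - u)"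
      have n: "1 \<le> n" using w n_def by simp
      have "m \<le> a + (1 / n) * (b - a)"
      \<comment> \<open>\<open>Gamma0_convex_le\<close> needs a parameter strictly below 1, so
        \<open>1 / n = 1\<close> is treated directly.\<close>
      proof (cases "n = 1")
        case True
        then show ?thesis using m0[of w] m 2 by (simp add: n_def dist_norm norm_minus_commute)
      next
        case False
        have "u + (1 / n) *\<^sub>R (w - u) \<in> cball u 1"
          using n by (simp add: dist_norm n_def[symmetric])
        from m0[OF this] Gamma0_convex_le[OF assms 2, of "1 / n"]
        have "\<phi> m0 \<le> ereal (a + (1 / n) * (b - a))"
          using n False by (auto intro: order_trans)
        then show ?thesis using m by simp
      qed
      then have "n * m \<le> n * (a + (1 / n) * (b - a))"
        using n by (intro mult_left_mono) auto
      also have "\<dots> = n * a + (b - a)" using n by (simp add: field_simps)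
      finally show ?thesis using 2 by (simp add: n_def[symmetric] algebra_simps)
    qed simp
  qed (use m in simp)
qed

text \<open>The quadratic term outgrows the at most linear decay of \<open>\<phi>\<close>, so a
  minimizer over a large ball is a global one. Existence then transfers to the point chosen by
  \<open>ARG_MIN\<close>.\<close>

lemma prox_is_arg_min:
  fixes \<phi> :: "'a::euclidean_space \<Rightarrow> ereal"
  assumes "\<phi> \<in> Gamma0"
  shows "\<phi> (prox \<phi> x) + ereal (1/2 * (norm (x - prox \<phi> x))\<^sup>2)
           \<le> \<phi> w + ereal (1/2 * (norm (x - w))\<^sup>2)"
proof -
  define \<psi> where "\<psi> w = \<phi> w + ereal (1/2 * (norm (x - w))\<^sup>2)" for w
  obtain u a where u: "\<phi> u = ereal a" using Gamma0_finite_point[OF assms] .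
  obtain c where c: "0 \<le> c" "\<And>w. norm (w - u) \<ge> 1 \<Longrightarrow> ereal (a - c * norm (w - u)) \<le> \<phi> w"
    using Gamma0_linear_lower_bound[OF assms u] by blast
  \<comment> \<open>For \<open>n > r\<close> half of \<open>n\<^sup>2\<close> dominates both the
    decay \<open>c * n\<close> and the cross term \<open>norm (x - u) * n\<close>; the summand 1
    ensures \<open>n \<ge> 1\<close>, where the linear bound applies.\<close>
  define r where "r = 1 + 2 * (c + norm (x - u))"
  have op: "open {w. c < \<psi> w}" for c
    unfolding \<psi>_def by (rule Gamma0_add_continuous_open_superlevel[OF assms]) (intro continuous_intros)
  have r: "0 < r" using c(1) by (simp add: r_def add_pos_nonneg)
  obtain p where p: "p \<in> cball u r" "\<And>w. w \<in> cball u r \<Longrightarrow> \<psi> p \<le> \<psi> w"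
    using attains_inf_if_open_superlevels[of "cball u r" \<psi>] op r
    by (metis compact_cball cball_eq_empty not_less_iff_gr_or_eq)
  have "\<psi> p \<le> \<psi> w" for w
  proof (cases "w \<in> cball u r")
    case False
    define n where "n = norm (w - u)"
    have n: "r < n" using False by (simp add: n_def dist_norm norm_minus_commute)
    have n1: "1 \<le> n" using n c(1) by (simp add: r_def) (smt (verit) norm_ge_zero)
    have "(norm (x - w))\<^sup>2 = (norm (x - u))\<^sup>2 - 2 * ((x - u) \<bullet> (w - u)) + n\<^sup>2"
      unfolding n_def power2_norm_eq_inner by (simp add: inner_diff_left inner_diff_right inner_commute)
    moreover have "(x - u) \<bullet> (w - u) \<le> norm (x - u) * n"
      unfolding n_def by (rule norm_cauchy_schwarz)
    moreover have "2 * (c + norm (x - u)) * n \<le> n * n"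
      using n n1 unfolding r_def by (intro mult_right_mono) auto
    ultimately have "a + 1/2 * (norm (x - u))\<^sup>2 \<le> (a - c * n) + 1/2 * (norm (x - w))\<^sup>2"
      by (simp add: algebra_simps power2_eq_square)
    then have "\<psi> u \<le> ereal (a - c * n) + ereal (1/2 * (norm (x - w))\<^sup>2)"
      unfolding \<psi>_def u by simp
    also have "\<dots> \<le> \<psi> w"
      unfolding \<psi>_def using c(2)[of w] n1 n_def by (intro add_right_mono) auto
    finally show ?thesis using p(2)[of u] r by (auto intro: order_trans)
  qed (rule p(2))
  then have "is_arg_min \<psi> (\<lambda>_. True) p"
    by (simp add: is_arg_min_linorder)
  then have "is_arg_min \<psi> (\<lambda>_. True) (prox \<phi> x)"
    unfolding prox_def arg_min_def \<psi>_def by (rule someI)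
  then show ?thesis
    by (simp add: is_arg_min_linorder \<psi>_def)
qed

section \<open>Subgradients and proximal operators\<close>

text \<open>The vector \<open>u\<close> lies in the subdifferential of \<open>\<phi>\<close> at
  \<open>p\<close>. Finiteness at \<open>p\<close> is required since at a value
  \<open>-\<infinity>\<close> the inequality would hold for every \<open>u\<close>.\<close>

definition subgradient :: "('a::real_inner \<Rightarrow> ereal) \<Rightarrow> 'a \<Rightarrow> 'a \<Rightarrow> bool" where
  "subgradient \<phi> p u \<longleftrightarrow> \<bar>\<phi> p\<bar> \<noteq> \<infinity> \<and> (\<forall>w. \<phi> p + ereal (u \<bullet> (w - p)) \<le> \<phi> w)"

text \<open>First-order optimality: compare the minimal value with the one at
  \<open>p + t *\<^sub>R (w - p)\<close>, bound \<open>\<phi>\<close> there by convexity, divide by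
  \<open>t\<close> and let \<open>t\<close> tend to 0.\<close>

lemma subgradient_prox:
  assumes "\<phi> \<in> Gamma0"
  shows "subgradient \<phi> (prox \<phi> x) (x - prox \<phi> x)"
proof -
  define p where "p = prox \<phi> x"
  have min: "\<phi> p + ereal (1/2 * (norm (x - p))\<^sup>2) \<le> \<phi> w + ereal (1/2 * (norm (x - w))\<^sup>2)" for w
    using prox_is_arg_min[OF assms] by (simp add: p_def)
  obtain u b where "\<phi> u = ereal b" using Gamma0_finite_point[OF assms] .
  then have "\<phi> p \<noteq> \<infinity>" using min[of u] by auto
  then obtain a where a: "\<phi> p = ereal a"
    by (cases rule: Gamma0_dom_cases[OF assms, of p]) auto
  have "\<phi> p + ereal ((x - p) \<bullet> (w - p)) \<le> \<phi> w" for w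
  proof (cases rule: Gamma0_dom_cases[OF assms, of w])
    case (2 b)
    have "0 \<le> (b - a - (x - p) \<bullet> (w - p)) + t * (1/2 * (norm (w - p))\<^sup>2)" if t: "0 < t" "t < 1" for t
    proof -
      have "ereal (a + 1/2 * (norm (x - p))\<^sup>2)
          \<le> ereal (a + t * (b - a)) + ereal (1/2 * (norm (x - (p + t *\<^sub>R (w - p))))\<^sup>2)"
        using order_trans[OF min add_right_mono[OF Gamma0_convex_le[OF assms a 2 t]]] a by simp
      moreover have "(norm (x - (p + t *\<^sub>R (w - p))))\<^sup>2
          = (norm (x - p))\<^sup>2 - 2 * t * ((x - p) \<bullet> (w - p)) + t * t * (norm (w - p))\<^sup>2"
        unfolding power2_norm_eq_inner by (simp add: inner_simps inner_commute algebra_simps)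
      ultimately have "0 \<le> t * ((b - a - (x - p) \<bullet> (w - p)) + t * (1/2 * (norm (w - p))\<^sup>2))"
        by (simp add: algebra_simps)
      then show ?thesis using t by (simp add: zero_le_mult_iff)
    qed
    from nonneg_if_affine_nonneg[OF this] show ?thesis using a 2 by simp
  qed simp
  then show ?thesis using a by (simp add: subgradient_def p_def)
qed

lemma subgradient_monotone:
  assumes "subgradient \<phi> p u" "subgradient \<phi> q w"
  shows "0 \<le> (u - w) \<bullet> (p - q)"
proof -
  obtain a b where ab: "\<phi> p = ereal a" "\<phi> q = ereal b"
    using assms by (auto simp: subgradient_def)
  have "a + u \<bullet> (q - p) \<le> b" "b + w \<bullet> (p - q) \<le> a"
    using assms ab unfolding subgradient_def by (metis ereal_less_eq(3) plus_ereal.simps(1))+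
  then show ?thesis by (simp add: inner_simps)
qed

text \<open>The proximal map is the resolvent of the subdifferential. For the converse, monotonicity
  applied to the two residuals yields minus the squared distance of the two candidates, so they
  coincide.\<close>

lemma prox_eq_iff_subgradient:
  assumes "\<phi> \<in> Gamma0"
  shows "prox \<phi> x = p \<longleftrightarrow> subgradient \<phi> p (x - p)"
proof
  assume "subgradient \<phi> p (x - p)"
  from subgradient_monotone[OF subgradient_prox[OF assms, of x] this]
  have "(prox \<phi> x - p) \<bullet> (prox \<phi> x - p) \<le> 0"
    by (simp add: inner_simps inner_commute)
  then have "(prox \<phi> x - p) \<bullet> (prox \<phi> x - p) = 0"
    by (intro antisym) auto
  then show "prox \<phi> x = p" by simp
qed (use subgradient_prox[OF assms] in auto)

text \<open>The residuals are subgradients at the proximal points, and the difference of the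
  proximal points is the difference of the arguments minus that of the residuals. Monotonicity of
  subgradients is then the claim.\<close>

lemma id_minus_prox_firmly_nonexpansive:
  assumes "\<phi> \<in> Gamma0"
  shows "(norm ((id - prox \<phi>) x - (id - prox \<phi>) w))\<^sup>2
    \<le> ((id - prox \<phi>) x - (id - prox \<phi>) w) \<bullet> (x - w)"
  using subgradient_monotone[OF subgradient_prox[OF assms, of x] subgradient_prox[OF assms, of w]]
  by (simp add: power2_norm_eq_inner inner_simps inner_commute)

lemma Gamma0_scale:
  fixes \<phi> :: "'a::euclidean_space \<Rightarrow> ereal"
  assumes "\<phi> \<in> Gamma0" "0 < c"
  shows "(\<lambda>u. ereal c * \<phi> u) \<in> Gamma0"
proof -
  have "proper (\<lambda>u. ereal c * \<phi> u)"
    using assms by (auto simp: Gamma0_def proper_def effective_domain_def ereal_mult_eq_MInfty ereal_mult_less_right)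
  moreover have "lower_semicontinuous (\<lambda>u. ereal c * \<phi> u)"
    unfolding lower_semicontinuous_def
  proof
    fix u
    have "Liminf (at u) (\<lambda>u. ereal c * \<phi> u) = ereal c * Liminf (at u) \<phi>"
      using assms by (subst Liminf_ereal_mult_left) auto
    then show "ereal c * \<phi> u \<le> Liminf (at u) (\<lambda>u. ereal c * \<phi> u)"
      using assms by (auto simp: Gamma0_def lower_semicontinuous_def intro!: ereal_mult_left_mono)
  qed
  moreover have "ereal_convex (\<lambda>u. ereal c * \<phi> u)"
    unfolding ereal_convex_def
  proof (intro allI ballI)
    fix x y :: 'a and t :: real assume t: "t \<in> {0<..<1}"
    have "\<phi> ((1 - t) *\<^sub>R x + t *\<^sub>R y) \<le> ereal (1 - t) * \<phi> x + ereal t * \<phi> y"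
      using assms t by (auto simp: Gamma0_def ereal_convex_def)
    from ereal_mult_left_mono[OF this, of "ereal c"]
    show "ereal c * \<phi> ((1 - t) *\<^sub>R x + t *\<^sub>R y) \<le> ereal (1 - t) * (ereal c * \<phi> x) + ereal t * (ereal c * \<phi> y)"
      using assms(2) Gamma0_not_MInf[OF assms(1), of x] Gamma0_not_MInf[OF assms(1), of y] t
      by (cases "\<phi> x"; cases "\<phi> y"; simp add: algebra_simps)
  qed
  ultimately show ?thesis by (simp add: Gamma0_def)
qed

lemma subgradient_scale_iff:
  assumes "0 < c"
  shows "subgradient (\<lambda>u. ereal c * \<phi> u) p (c *\<^sub>R u) \<longleftrightarrow> subgradient \<phi> p u"
proof -
  have "ereal c * \<phi> p + ereal ((c *\<^sub>R u) \<bullet> (w - p)) \<le> ereal c * \<phi> w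
    \<longleftrightarrow> \<phi> p + ereal (u \<bullet> (w - p)) \<le> \<phi> w" for w
  proof -
    have "c * a + c * (u \<bullet> (w - p)) \<le> c * b \<longleftrightarrow> a + u \<bullet> (w - p) \<le> b" for a b
      using assms by (metis distrib_left mult_le_cancel_left_pos)
    then show ?thesis using assms by (cases "\<phi> p"; cases "\<phi> w"; simp)
  qed
  moreover have "\<bar>ereal c * \<phi> p\<bar> \<noteq> \<infinity> \<longleftrightarrow> \<bar>\<phi> p\<bar> \<noteq> \<infinity>"
    using assms by (cases "\<phi> p") auto
  ultimately show ?thesis by (simp add: subgradient_def)
qed

text \<open>Translates each component of the fixed-point equation into a subgradient inclusion: the
  equation says that the proximal point is \<open>u\<close>, hence that \<open>c *\<^sub>R p\<close>
  is a subgradient of the scaled function.\<close>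

lemma id_minus_prox_scaled_fixed_iff:
  fixes \<phi> :: "'a::euclidean_space \<Rightarrow> ereal"
  assumes "\<phi> \<in> Gamma0" "0 < c"
  shows "(id - prox (\<lambda>w. ereal c * \<phi> w)) (u + c *\<^sub>R p) = c *\<^sub>R p \<longleftrightarrow> subgradient \<phi> u p"
proof -
  have "(id - prox (\<lambda>w. ereal c * \<phi> w)) (u + c *\<^sub>R p) = c *\<^sub>R p
      \<longleftrightarrow> prox (\<lambda>w. ereal c * \<phi> w) (u + c *\<^sub>R p) = u"
    by (auto simp: algebra_simps)
  also have "\<dots> \<longleftrightarrow> subgradient \<phi> u p"
    using prox_eq_iff_subgradient[OF Gamma0_scale[OF assms]] subgradient_scale_iff[OF assms(2)] by simp
  finally show ?thesis .
qed

section \<open>Lipschitz gradients and cocoercivity\<close>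

lemma GDERIV_along_line:
  assumes "GDERIV f (x + t *\<^sub>R d) :> G"
  shows "((\<lambda>t. f (x + t *\<^sub>R d)) has_real_derivative G \<bullet> d) (at t)"
proof -
  have "(f has_derivative (\<lambda>h. h \<bullet> G)) (at (x + t *\<^sub>R d))"
    using assms by (simp add: gderiv_def)
  moreover have "((\<lambda>t. x + t *\<^sub>R d) has_derivative (\<lambda>s. s *\<^sub>R d)) (at t)"
    by (auto intro!: derivative_eq_intros)
  ultimately have "((\<lambda>t. f (x + t *\<^sub>R d)) has_derivative (\<lambda>s. (s *\<^sub>R d) \<bullet> G)) (at t)"
    using has_derivative_compose[of "\<lambda>t. x + t *\<^sub>R d" "\<lambda>s. s *\<^sub>R d" t UNIV f
        "\<lambda>h. h \<bullet> G"] by simp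
  then show ?thesis
    by (simp add: has_field_derivative_def inner_commute mult.commute[of _ "_ \<bullet> _"])
qed

text \<open>The gap \<open>r\<close> between \<open>f\<close> along the segment and its quadratic
  model is nonincreasing, because Cauchy-Schwarz and the Lipschitz bound make its derivative
  nonpositive.\<close>

lemma descent_lemma:
  assumes G: "\<And>u. GDERIV f u :> G u" and lip: "L-lipschitz_on UNIV G"
  shows "f (x + d) \<le> f x + G x \<bullet> d + L / 2 * (norm d)\<^sup>2"
proof -
  define r where "r t = f (x + t *\<^sub>R d) - t * (G x \<bullet> d) - L / 2 * t\<^sup>2 * (norm d)\<^sup>2" for t
  have "r 1 \<le> r 0"
  proof (rule DERIV_nonpos_imp_nonincreasing[of 0 1])
    fix t :: real assume t: "0 \<le> t" "t \<le> 1"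
    have "(r has_real_derivative (G (x + t *\<^sub>R d) \<bullet> d - G x \<bullet> d - L * t * (norm d)\<^sup>2)) (at t)"
      unfolding r_def by (auto intro!: derivative_eq_intros GDERIV_along_line[OF G])
    moreover have "G (x + t *\<^sub>R d) \<bullet> d - G x \<bullet> d - L * t * (norm d)\<^sup>2 \<le> 0"
    proof -
      have "G (x + t *\<^sub>R d) \<bullet> d - G x \<bullet> d = (G (x + t *\<^sub>R d) - G x) \<bullet> d"
        by (simp add: inner_diff_left)
      also have "\<dots> \<le> norm (G (x + t *\<^sub>R d) - G x) * norm d"
        by (rule norm_cauchy_schwarz)
      also have "\<dots> \<le> (L * (t * norm d)) * norm d"
        using lipschitz_onD[OF lip, of "x + t *\<^sub>R d" x] t
        by (intro mult_right_mono) (auto simp: dist_norm)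
      finally show ?thesis by (simp add: power2_eq_square algebra_simps)
    qed
    ultimately show "\<exists>y. (r has_real_derivative y) (at t) \<and> y \<le> 0" by blast
  qed simp
  then show ?thesis by (simp add: r_def)
qed

text \<open>Baillon-Haddad: the upper model at one point against the tangent at the other sharpens
  the convexity inequality by a squared gradient difference; adding the version with the points
  swapped cancels the function values.\<close>

lemma gradient_cocoercive:
  assumes G: "\<And>u. GDERIV f u :> G u" and lip: "L-lipschitz_on UNIV G" and L: "0 < L"
    and conv: "\<And>u w. f u + G u \<bullet> (w - u) \<le> f w"
  shows "1 / L * (norm (G x - G y))\<^sup>2 \<le> (G x - G y) \<bullet> (x - y)"
proof -
  have *: "1 / (2 * L) * (norm (G x - G y))\<^sup>2 \<le> f x - f y - G y \<bullet> (x - y)" for x y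
  proof -
    \<comment> \<open>The step \<open>d\<close> minimizes the upper bound of the descent lemma minus the tangent at \<open>y\<close>.\<close>
    define d where "d = - (1 / L) *\<^sub>R (G x - G y)"
    have "f y + G y \<bullet> (x + d - y) \<le> f x + G x \<bullet> d + L / 2 * (norm d)\<^sup>2"
      using conv[of y "x + d"] descent_lemma[OF G lip, of x d] by linarith
    moreover have "L / 2 * (norm d)\<^sup>2 = 1 / (2 * L) * (norm (G x - G y))\<^sup>2"
      using L unfolding d_def norm_scaleR by (simp add: power2_eq_square field_simps)
    moreover have "G x \<bullet> d - G y \<bullet> d = - (1 / L) * (norm (G x - G y))\<^sup>2"
      by (simp add: d_def power2_norm_eq_inner inner_simps algebra_simps)
    moreover have "1 / L * (norm (G x - G y))\<^sup>2 = 2 * (1 / (2 * L) * (norm (G x - G y))\<^sup>2)"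
      by simp
    ultimately show ?thesis
      unfolding inner_diff_right inner_add_right by linarith
  qed
  have "1 / (2 * L) * (norm (G x - G y))\<^sup>2 + 1 / (2 * L) * (norm (G x - G y))\<^sup>2 \<le> (G x - G y) \<bullet> (x - y)"
    using *[of x y] *[of y x] by (simp add: inner_simps norm_minus_commute)
  then show ?thesis by (simp add: field_simps)
qed

section \<open>The largest eigenvalue as a norm bound\<close>

text \<open>Eigenvectors for distinct eigenvalues are orthogonal, hence independent, and the
  dimension is finite. This gives the \<open>Max\<close> in \<open>lambda_max\<close> its
  meaning.\<close>

lemma finite_eigenvalues_selfadjoint:
  fixes T :: "'a::euclidean_space \<Rightarrow> 'a"
  assumes "\<And>u w. T u \<bullet> w = u \<bullet> T w"
  shows "finite (eigenvalues T)"
proof -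
  have "\<forall>\<mu>\<in>eigenvalues T. \<exists>w. w \<noteq> 0 \<and> T w = \<mu> *\<^sub>R w"
    by (simp add: eigenvalues_def)
  from bchoice[OF this]
  obtain e where e: "\<And>\<mu>. \<mu> \<in> eigenvalues T \<Longrightarrow> e \<mu> \<noteq> 0 \<and> T (e \<mu>) = \<mu> *\<^sub>R e \<mu>"
    by blast
  have orth: "e \<mu> \<bullet> e \<nu> = 0" if "\<mu> \<in> eigenvalues T" "\<nu> \<in> eigenvalues T" "\<mu> \<noteq> \<nu>" for \<mu> \<nu>
    using assms[of "e \<mu>" "e \<nu>"] e[OF that(1)] e[OF that(2)] that(3) by simp
  then have "inj_on e (eigenvalues T)"
    using e by (metis inj_onI inner_eq_zero_iff)
  moreover have "independent (e ` eigenvalues T)"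
    using e orth by (intro pairwise_orthogonal_independent) (force simp: pairwise_def orthogonal_def)+
  ultimately show ?thesis
    using finiteI_independent finite_image_iff by blast
qed

text \<open>The maximum \<open>\<mu>\<close> of the squared norm of \<open>adjoint D\<close> on the
  unit sphere is an eigenvalue of \<open>D \<circ> adjoint D\<close>, so \<open>lambda_max\<close>
  bounds it; homogeneity extends the estimate to all vectors.\<close>

lemma norm_adjoint_le_lambda_max:
  fixes D :: "'a::euclidean_space \<Rightarrow> 'b::euclidean_space"
  assumes "linear D"
  shows "(norm (adjoint D u))\<^sup>2 \<le> lambda_max (D \<circ> adjoint D) * (norm u)\<^sup>2"
proof -
  define T where "T = adjoint D"
  have T: "linear T" "\<And>u w. T u \<bullet> w = u \<bullet> D w" "\<And>u w. w \<bullet> T u = D w \<bullet> u"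
    unfolding T_def using adjoint_linear adjoint_works adjoint_clauses assms by metis+
  have "\<exists>w\<in>sphere 0 1. \<forall>u\<in>sphere 0 1. (norm (T u))\<^sup>2 \<le> (norm (T w))\<^sup>2"
    by (intro continuous_attains_sup continuous_intros linear_continuous_on T(1)
        linear_conv_bounded_linear[THEN iffD1]) (auto simp: sphere_eq_empty)
  then obtain w where w: "norm w = 1" "\<And>u. norm u = 1 \<Longrightarrow> (norm (T u))\<^sup>2 \<le> (norm (T w))\<^sup>2"
    by auto
  define \<mu> where "\<mu> = (norm (T w))\<^sup>2"
  have le: "(norm (T u))\<^sup>2 \<le> \<mu> * (norm u)\<^sup>2" for u
  proof (cases "u = 0")
    case False
    have "(norm (T ((1 / norm u) *\<^sub>R u)))\<^sup>2 \<le> \<mu>"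
      unfolding \<mu>_def using False by (intro w(2)) simp
    then show ?thesis
      using False by (simp add: linear_scale[OF T(1)] power_divide field_simps)
  qed (simp add: linear_0[OF T(1)])
  \<comment> \<open>The form \<open>\<mu> * (norm u)\<^sup>2 - (norm (T u))\<^sup>2\<close> is nonnegative and vanishes at \<open>w\<close>, so its gradient vanishes there.\<close>
  have "D (T w) - \<mu> *\<^sub>R w = 0"
  proof -
    define d where "d = D (T w) - \<mu> *\<^sub>R w"
    have "0 \<le> - 2 * (norm d)\<^sup>2 + t * (\<mu> * (norm d)\<^sup>2 - (norm (T d))\<^sup>2)" if "0 < t" for t
    proof -
      have "(norm (T (w + t *\<^sub>R d)))\<^sup>2 = \<mu> + 2 * t * (D (T w) \<bullet> d) + t * t * (norm (T d))\<^sup>2"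
        unfolding \<mu>_def power2_norm_eq_inner linear_add[OF T(1)] linear_scale[OF T(1)] inner_simps
        using T(3)[of "T w" d] by (simp add: inner_commute algebra_simps)
      moreover have "(norm (w + t *\<^sub>R d))\<^sup>2 = 1 + 2 * t * (w \<bullet> d) + t * t * (norm d)\<^sup>2"
        using w(1) unfolding norm_eq_1 power2_norm_eq_inner by (simp add: inner_simps inner_commute algebra_simps)
      moreover have "D (T w) \<bullet> d = (norm d)\<^sup>2 + \<mu> * (w \<bullet> d)"
        by (simp add: d_def power2_norm_eq_inner inner_simps inner_commute algebra_simps)
      ultimately have "0 \<le> t * (- 2 * (norm d)\<^sup>2 + t * (\<mu> * (norm d)\<^sup>2 - (norm (T d))\<^sup>2))"
        using le[of "w + t *\<^sub>R d"] by (simp add: algebra_simps)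
      then show ?thesis using that by (simp add: zero_le_mult_iff)
    qed
    then have "0 \<le> - 2 * (norm d)\<^sup>2"
      by (intro tendsto_lowerbound[where F = "at_right 0" and
            f = "\<lambda>t. - 2 * (norm d)\<^sup>2 + t * (\<mu> * (norm d)\<^sup>2 - (norm (T d))\<^sup>2)"])
        (auto intro!: tendsto_eq_intros simp: eventually_at_right_less eventually_at_filter)
    then show ?thesis by (simp add: d_def)
  qed
  then have "\<mu> \<in> eigenvalues (D \<circ> T)"
    using w(1) by (auto simp: eigenvalues_def intro!: exI[of _ w])
  moreover have "finite (eigenvalues (D \<circ> T))"
    using T by (intro finite_eigenvalues_selfadjoint) (simp add: T(3)[symmetric] T(2)[symmetric])
  ultimately have "\<mu> \<le> lambda_max (D \<circ> T)"
    unfolding lambda_max_def by (rule Max_ge[rotated])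
  then show ?thesis
    using le[of u] mult_right_mono[of \<mu> "lambda_max (D \<circ> T)" "(norm u)\<^sup>2"] by (simp add: T_def)
qed

section \<open>Convergence of the abstract primal-dual iteration\<close>

text \<open>Twice the firm nonexpansiveness inequality cancels the cross term
  \<open>T b \<bullet> q\<close> in the expansion of the new primal error. The other inner products
  are absorbed by expanding the squares of \<open>b - a\<close> and \<open>T (b - a)\<close>;
  cocoercivity bounds the error \<open>q\<close>.\<close>

lemma primal_dual_fixed_point_descent:
  fixes B :: "'a::euclidean_space \<Rightarrow> 'c::euclidean_space"
  assumes B: "linear B"
    and coco: "\<And>u w. \<beta> * (norm (G u - G w))\<^sup>2 \<le> (G u - G w) \<bullet> (u - w)"
    and firm: "\<And>p q. (norm (Q p - Q q))\<^sup>2 \<le> (Q p - Q q) \<bullet> (p - q)"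
    and \<gamma>: "0 < \<gamma>" and lam: "0 < lam"
    and z': "z' = Q (B (x - \<gamma> *\<^sub>R G x) + z - lam *\<^sub>R B (adjoint B z))"
    and x': "x' = x - \<gamma> *\<^sub>R G x - lam *\<^sub>R adjoint B z'"
    and fix1: "Q (B xs + zs) = zs" and fix2: "\<gamma> *\<^sub>R G xs + lam *\<^sub>R adjoint B zs = 0"
  shows "(norm (x' - xs))\<^sup>2 + lam * (norm (z' - zs))\<^sup>2
      + \<gamma> * (2 * \<beta> - \<gamma>) * (norm (G x - G xs))\<^sup>2 + lam\<^sup>2 * (norm (adjoint B (z - zs)))\<^sup>2
      + lam * ((norm (z' - z))\<^sup>2 - lam * (norm (adjoint B (z' - z)))\<^sup>2)
    \<le> (norm (x - xs))\<^sup>2 + lam * (norm (z - zs))\<^sup>2"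
proof -
  define T where "T = adjoint B"
  have T: "linear T" "\<And>p u. p \<bullet> B u = T p \<bullet> u"
    unfolding T_def using adjoint_linear adjoint_clauses B by metis+
  \<comment> \<open>\<open>q\<close> is the error after the gradient step; \<open>a\<close> and
    \<open>b\<close> are the dual errors before and after the update.\<close>
  define q where "q = (x - xs) - \<gamma> *\<^sub>R (G x - G xs)"
  define a where "a = z - zs"
  define b where "b = z' - zs"
  have zz: "z' - z = b - a" by (simp add: a_def b_def)
  have xs: "\<gamma> *\<^sub>R G xs = - (lam *\<^sub>R T zs)"
    using fix2 by (simp add: T_def add_eq_0_iff2)
  have x's: "x' - xs = q - lam *\<^sub>R T b"
    using xs by (simp add: x' q_def b_def linear_diff[OF T(1)] T_def[symmetric] algebra_simps)
  \<comment> \<open>The balance equation \<open>fix2\<close> identifies \<open>B xs + zs\<close>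
    with the argument of \<open>Q\<close> formed at the fixed point, so the difference is linear in
    \<open>q\<close> and \<open>a\<close>.\<close>
  have "B (x - \<gamma> *\<^sub>R G x) + z - lam *\<^sub>R B (T z) - (B xs + zs) = B q + a - lam *\<^sub>R B (T a)"
  proof -
    have "B q = B (x - \<gamma> *\<^sub>R G x) - B xs - lam *\<^sub>R B (T zs)"
      unfolding q_def scaleR_diff_right xs
      by (simp add: linear_diff[OF B] linear_add[OF B] linear_scale[OF B] linear_neg[OF B] algebra_simps)
    then show ?thesis
      by (simp add: a_def linear_diff[OF T(1)] linear_diff[OF B] algebra_simps)
  qed
  then have "(norm b)\<^sup>2 \<le> b \<bullet> (B q + a - lam *\<^sub>R B (T a))"
    using firm[of "B (x - \<gamma> *\<^sub>R G x) + z - lam *\<^sub>R B (T z)" "B xs + zs"] fix1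
    by (simp add: z' b_def T_def)
  also have "\<dots> = T b \<bullet> q + b \<bullet> a - lam * (T b \<bullet> T a)"
    by (simp add: inner_simps T(2))
  finally have "lam * (norm b)\<^sup>2 \<le> lam * (T b \<bullet> q + b \<bullet> a - lam * (T b \<bullet> T a))"
    using lam by simp
  moreover have "(norm (x' - xs))\<^sup>2 = (norm q)\<^sup>2 - 2 * lam * (T b \<bullet> q) + lam\<^sup>2 * (norm (T b))\<^sup>2"
    unfolding x's power2_norm_eq_inner
    by (simp add: inner_simps inner_commute power2_eq_square algebra_simps)
  moreover have "(norm q)\<^sup>2 \<le> (norm (x - xs))\<^sup>2 - \<gamma> * (2 * \<beta> - \<gamma>) * (norm (G x - G xs))\<^sup>2"
  proof -
    have "(norm q)\<^sup>2 = (norm (x - xs))\<^sup>2 - 2 * \<gamma> * ((G x - G xs) \<bullet> (x - xs)) + \<gamma>\<^sup>2 * (norm (G x - G xs))\<^sup>2"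
      unfolding q_def power2_norm_eq_inner
      by (simp add: inner_simps inner_commute power2_eq_square algebra_simps)
    moreover have "\<gamma> * (\<beta> * (norm (G x - G xs))\<^sup>2) \<le> \<gamma> * ((G x - G xs) \<bullet> (x - xs))"
      using \<gamma> coco by simp
    ultimately show ?thesis by (simp add: power2_eq_square algebra_simps)
  qed
  moreover have "lam * (norm (b - a))\<^sup>2 = lam * (norm b)\<^sup>2 - 2 * lam * (b \<bullet> a) + lam * (norm a)\<^sup>2"
    unfolding power2_norm_eq_inner by (simp add: inner_simps inner_commute algebra_simps)
  moreover have "lam\<^sup>2 * (norm (T (b - a)))\<^sup>2
      = lam\<^sup>2 * (norm (T b))\<^sup>2 - 2 * lam\<^sup>2 * (T b \<bullet> T a) + lam\<^sup>2 * (norm (T a))\<^sup>2"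
    unfolding linear_diff[OF T(1)] power2_norm_eq_inner
    by (simp add: inner_simps inner_commute algebra_simps)
  ultimately show ?thesis
    unfolding zz T_def[symmetric] a_def[symmetric] b_def[symmetric]
    by (simp add: power2_eq_square algebra_simps)
qed

text \<open>\<open>V\<close> is decreasing and bounded below, so its consecutive differences vanish
  in the limit and squeeze \<open>e\<close>.\<close>

lemma LIMSEQ_zero_if_summed_descent:
  fixes V e :: "nat \<Rightarrow> real"
  assumes "\<And>k. V (Suc k) + e k \<le> V k" "\<And>k. 0 \<le> V k" "\<And>k. 0 \<le> e k"
  shows "e \<longlonglongrightarrow> 0"
proof -
  have "decseq V" using assms(1,3) by (intro decseq_SucI) (smt (verit))
  then obtain l where "V \<longlonglongrightarrow> l"
    using decseq_convergent[of V 0] assms(2) by blast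
  then have "(\<lambda>k. V k - V (Suc k)) \<longlonglongrightarrow> 0"
    using tendsto_diff[OF _ LIMSEQ_Suc, of V l V l] by simp
  then show ?thesis
    by (rule tendsto_sandwich[OF _ _ tendsto_const, rotated 2])
      (use assms in \<open>auto intro!: always_eventually simp: le_diff_eq add.commute\<close>)
qed

lemma LIMSEQ_norm_zero_if_scaled_square:
  fixes w :: "nat \<Rightarrow> 'a::real_normed_vector"
  assumes "(\<lambda>k. c * (norm (w k))\<^sup>2) \<longlonglongrightarrow> 0" "c \<noteq> 0"
  shows "w \<longlonglongrightarrow> 0"
proof -
  have "(\<lambda>k. (1 / c) * (c * (norm (w k))\<^sup>2)) \<longlonglongrightarrow> (1 / c) * 0"
    by (intro tendsto_intros assms)
  then have "(\<lambda>k. sqrt ((norm (w k))\<^sup>2)) \<longlonglongrightarrow> sqrt 0"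
    using assms(2) by (intro tendsto_intros) simp
  then show ?thesis by (simp add: tendsto_norm_zero_iff)
qed

text \<open>Fejer monotonicity in finite dimension. The given fixed point \<open>(x0, z0)\<close>
  supplies boundedness and vanishing residuals; the limit is a cluster point, in general a different
  fixed point.\<close>

lemma primal_dual_fixed_point_convergence:
  fixes B :: "'a::euclidean_space \<Rightarrow> 'c::euclidean_space"
  assumes B: "linear B" and \<beta>: "0 < \<beta>"
    and coco: "\<And>u w. \<beta> * (norm (G u - G w))\<^sup>2 \<le> (G u - G w) \<bullet> (u - w)"
    and firm: "\<And>p q. (norm (Q p - Q q))\<^sup>2 \<le> (Q p - Q q) \<bullet> (p - q)"
    and \<gamma>: "0 < \<gamma>" "\<gamma> < 2 * \<beta>" and lam: "0 < lam"
    and psd: "\<And>p. lam * (norm (adjoint B p))\<^sup>2 \<le> (norm p)\<^sup>2"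
    and z_step: "\<And>k. z (Suc k) = Q (B (x k - \<gamma> *\<^sub>R G (x k)) + z k - lam *\<^sub>R B (adjoint B (z k)))"
    and x_step: "\<And>k. x (Suc k) = x k - \<gamma> *\<^sub>R G (x k) - lam *\<^sub>R adjoint B (z (Suc k))"
    and fixed: "Q (B x0 + z0) = z0" "\<gamma> *\<^sub>R G x0 + lam *\<^sub>R adjoint B z0 = 0"
  obtains xs zs where "Q (B xs + zs) = zs" "\<gamma> *\<^sub>R G xs + lam *\<^sub>R adjoint B zs = 0" "x \<longlonglongrightarrow> xs"
proof -
  define T where "T = adjoint B"
  have T: "linear T" unfolding T_def using B by (rule adjoint_linear)
  define V where "V u p k = (norm (x k - u))\<^sup>2 + lam * (norm (z k - p))\<^sup>2" for u p k
  define e where "e u p k = \<gamma> * (2 * \<beta> - \<gamma>) * (norm (G (x k) - G u))\<^sup>2 + lam\<^sup>2 * (norm (T (z k - p)))\<^sup>2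
      + lam * ((norm (z (Suc k) - z k))\<^sup>2 - lam * (norm (T (z (Suc k) - z k)))\<^sup>2)" for u p k
  have desc: "V u p (Suc k) + e u p k \<le> V u p k"
    if "Q (B u + p) = p" "\<gamma> *\<^sub>R G u + lam *\<^sub>R T p = 0" for u p k
    using primal_dual_fixed_point_descent[OF B coco firm \<gamma>(1) lam z_step x_step that[unfolded T_def], of k]
    by (simp add: V_def e_def T_def algebra_simps)
  have V0: "0 \<le> V u p k" for u p k
    using lam by (simp add: V_def)
  have M0: "0 \<le> lam * ((norm (z (Suc k) - z k))\<^sup>2 - lam * (norm (T (z (Suc k) - z k)))\<^sup>2)" for k
    using lam psd T_def by (simp add: zero_le_mult_iff)
  have e0: "0 \<le> e u p k" for u p k
    unfolding e_def using M0[of k] \<gamma> by (intro add_nonneg_nonneg) auto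
  have e_lim: "e x0 z0 \<longlonglongrightarrow> 0"
    using LIMSEQ_zero_if_summed_descent[of "V x0 z0" "e x0 z0"] desc fixed V0 e0 T_def by blast
  have bound: "(\<lambda>k. r k) \<longlonglongrightarrow> 0" if "\<And>k. 0 \<le> r k" "\<And>k. r k \<le> e x0 z0 k" for r
    using tendsto_sandwich[OF _ _ tendsto_const e_lim, of r] that by (simp add: always_eventually)
  have "(\<lambda>k. (\<gamma> * (2 * \<beta> - \<gamma>)) * (norm (G (x k) - G x0))\<^sup>2) \<longlonglongrightarrow> 0"
    by (rule bound) (use M0 \<gamma> in \<open>auto simp: e_def intro!: add_nonneg_nonneg\<close>)
  then have G_lim: "(\<lambda>k. G (x k) - G x0) \<longlonglongrightarrow> 0"
    by (rule LIMSEQ_norm_zero_if_scaled_square) (use \<gamma> in auto)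
  have "(\<lambda>k. lam\<^sup>2 * (norm (T (z k - z0)))\<^sup>2) \<longlonglongrightarrow> 0"
  proof (rule bound)
    show "lam\<^sup>2 * (norm (T (z k - z0)))\<^sup>2 \<le> e x0 z0 k" for k
      unfolding e_def using M0[of k] mult_nonneg_nonneg[of "\<gamma> * (2 * \<beta> - \<gamma>)" "(norm (G (x k) - G x0))\<^sup>2"] \<gamma> by simp
  qed simp
  then have T_lim: "(\<lambda>k. T (z k - z0)) \<longlonglongrightarrow> 0"
    by (rule LIMSEQ_norm_zero_if_scaled_square) (use lam in auto)
  have Tdz: "(\<lambda>k. T (z (Suc k) - z k)) \<longlonglongrightarrow> 0"
    using tendsto_diff[OF LIMSEQ_Suc[OF T_lim] T_lim] by (simp add: linear_diff[OF T])
  \<comment> \<open>The form in \<open>e\<close> is only positive semidefinite. Adding back the term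
    with \<open>T (z (Suc k) - z k)\<close>, which vanishes separately, recovers the full
    norm.\<close>
  have dz: "(\<lambda>k. z (Suc k) - z k) \<longlonglongrightarrow> 0"
  proof (rule LIMSEQ_norm_zero_if_scaled_square)
    have "(\<lambda>k. lam * ((norm (z (Suc k) - z k))\<^sup>2 - lam * (norm (T (z (Suc k) - z k)))\<^sup>2)) \<longlonglongrightarrow> 0"
      using M0 \<gamma> by (intro bound) (auto simp: e_def)
    moreover have "(\<lambda>k. lam\<^sup>2 * (norm (T (z (Suc k) - z k)))\<^sup>2) \<longlonglongrightarrow> lam\<^sup>2 * (norm (0::'a))\<^sup>2"
      by (intro tendsto_intros Tdz)
    ultimately have "(\<lambda>k. lam * ((norm (z (Suc k) - z k))\<^sup>2 - lam * (norm (T (z (Suc k) - z k)))\<^sup>2)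
       + lam\<^sup>2 * (norm (T (z (Suc k) - z k)))\<^sup>2) \<longlonglongrightarrow> 0"
      using tendsto_add by fastforce
    then show "(\<lambda>k. lam * (norm (z (Suc k) - z k))\<^sup>2) \<longlonglongrightarrow> 0"
      by (simp add: algebra_simps power2_eq_square)
  qed (use lam in simp)
  have dx: "(\<lambda>k. x (Suc k) - x k) \<longlonglongrightarrow> 0"
  proof -
    \<comment> \<open>Subtracting the balance equation at \<open>(x0, z0)\<close> leaves only
      quantities known to vanish.\<close>
    have "x (Suc k) - x k = - (\<gamma> *\<^sub>R (G (x k) - G x0)) - lam *\<^sub>R T (z (Suc k) - z0)" for k
      using fixed(2) by (simp add: x_step T_def[symmetric] linear_diff[OF T] algebra_simps add_eq_0_iff2)
    moreover have "(\<lambda>k. - (\<gamma> *\<^sub>R (G (x k) - G x0)) - lam *\<^sub>R T (z (Suc k) - z0)) \<longlonglongrightarrow> - (\<gamma> *\<^sub>R 0) - lam *\<^sub>R 0"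
      by (intro tendsto_intros G_lim LIMSEQ_Suc[OF T_lim])
    ultimately show ?thesis by simp
  qed
  have dec: "decseq (V u p)" if "Q (B u + p) = p" "\<gamma> *\<^sub>R G u + lam *\<^sub>R T p = 0" for u p
    using desc[OF that] e0[of u p] by (intro decseq_SucI) (smt (verit))
  have V_le: "V x0 z0 k \<le> V x0 z0 0" for k
    using dec[of x0 z0] fixed T_def by (simp add: decseq_def)
  have "bounded (range (\<lambda>k. (x k, z k)))"
  proof -
    define R where "R = V x0 z0 0"
    have "norm (x k - x0) \<le> sqrt R" for k
    proof (rule real_le_rsqrt)
      have "0 \<le> lam * (norm (z k - z0))\<^sup>2" using lam by simp
      then show "(norm (x k - x0))\<^sup>2 \<le> R"
        using V_le[of k] unfolding V_def R_def by linarith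
    qed
    moreover have "norm (z k - z0) \<le> sqrt (R / lam)" for k
    proof (rule real_le_rsqrt)
      have "lam * (norm (z k - z0))\<^sup>2 \<le> R"
        using V_le[of k] zero_le_power2[of "norm (x k - x0)"] unfolding V_def R_def by linarith
      then show "(norm (z k - z0))\<^sup>2 \<le> R / lam" using lam by (simp add: field_simps)
    qed
    ultimately have "range (\<lambda>k. (x k, z k)) \<subseteq> cball x0 (sqrt R) \<times> cball z0 (sqrt (R / lam))"
      by (auto simp: dist_norm norm_minus_commute)
    then show ?thesis
      by (rule bounded_subset[rotated]) (intro bounded_Times bounded_cball)
  qed
  then obtain l r where r: "strict_mono (r :: nat \<Rightarrow> nat)" "((\<lambda>k. (x k, z k)) \<circ> r) \<longlonglongrightarrow> l"
    using bounded_imp_convergent_subsequence by metis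
  define xs where "xs = fst l"
  define zs where "zs = snd l"
  have xr: "(\<lambda>k. x (r k)) \<longlonglongrightarrow> xs" and zr: "(\<lambda>k. z (r k)) \<longlonglongrightarrow> zs"
    using tendsto_fst[OF r(2)] tendsto_snd[OF r(2)] by (simp_all add: xs_def zs_def o_def)
  have sub: "(\<lambda>k. w (r k)) \<longlonglongrightarrow> c" if "w \<longlonglongrightarrow> c" for w :: "nat \<Rightarrow> 'z::topological_space" and c
    using LIMSEQ_subseq_LIMSEQ[OF that r(1)] by (simp add: o_def)
  \<comment> \<open>The update links the indices \<open>r k\<close> and \<open>Suc (r k)\<close>;
    vanishing increments give both subsequences the same limit.\<close>
  have xr': "(\<lambda>k. x (Suc (r k))) \<longlonglongrightarrow> xs"
    using tendsto_add[OF sub[OF dx] xr] by simp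
  have zr': "(\<lambda>k. z (Suc (r k))) \<longlonglongrightarrow> zs"
    using tendsto_add[OF sub[OF dz] zr] by simp
  \<comment> \<open>Cocoercivity and Cauchy-Schwarz make \<open>G\<close> Lipschitz; below, firmness
    does the same for \<open>Q\<close>.\<close>
  have contG: "isCont G u" for u
  proof (rule continuous_on_interior[of UNIV], rule lipschitz_on_continuous_on[of "1 / \<beta>"], rule lipschitz_onI)
    fix u w
    have "\<beta> * (norm (G u - G w))\<^sup>2 \<le> norm (G u - G w) * norm (u - w)"
      using coco norm_cauchy_schwarz order_trans by blast
    then have "\<beta> * norm (G u - G w) \<le> norm (u - w)"
      by (cases "G u = G w") (auto simp: power2_eq_square)
    then show "dist (G u) (G w) \<le> 1 / \<beta> * dist u w"
      using \<beta> by (simp add: dist_norm field_simps)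
  qed (use \<beta> in auto)
  have contQ: "isCont Q p" for p
  proof (rule continuous_on_interior[of UNIV], rule lipschitz_on_continuous_on[of 1], rule lipschitz_onI)
    fix p q
    have "(norm (Q p - Q q))\<^sup>2 \<le> norm (Q p - Q q) * norm (p - q)"
      using firm norm_cauchy_schwarz order_trans by blast
    then show "dist (Q p) (Q q) \<le> 1 * dist p q"
      by (cases "Q p = Q q") (auto simp: power2_eq_square dist_norm)
  qed auto
  have contB: "isCont B u" for u
    using B linear_continuous_at linear_conv_bounded_linear by blast
  have contT: "isCont T u" for u
    using T linear_continuous_at linear_conv_bounded_linear by blast
  have Gr: "(\<lambda>k. G (x (r k))) \<longlonglongrightarrow> G xs" and Tr: "(\<lambda>k. T (z (Suc (r k)))) \<longlonglongrightarrow> T zs"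
    using isCont_tendsto_compose[OF contG xr] isCont_tendsto_compose[OF contT zr'] by simp_all
  have fix2: "\<gamma> *\<^sub>R G xs + lam *\<^sub>R T zs = 0"
  proof -
    have "(\<lambda>k. x (Suc (r k))) \<longlonglongrightarrow> xs - \<gamma> *\<^sub>R G xs - lam *\<^sub>R T zs"
      unfolding x_step T_def[symmetric] by (intro tendsto_intros xr Gr Tr[unfolded z_step] Tr)
    from LIMSEQ_unique[OF this xr'] show ?thesis by (simp add: algebra_simps)
  qed
  have fix1: "Q (B xs + zs) = zs"
  proof -
    have "(\<lambda>k. z (Suc (r k))) \<longlonglongrightarrow> Q (B (xs - \<gamma> *\<^sub>R G xs) + zs - lam *\<^sub>R B (T zs))"
      unfolding z_step T_def[symmetric]
      by (intro isCont_tendsto_compose[OF contQ] isCont_tendsto_compose[OF contB]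
          isCont_tendsto_compose[OF contT] tendsto_intros xr zr Gr)
    from LIMSEQ_unique[OF this zr'] have "Q (B (xs - \<gamma> *\<^sub>R G xs) + zs - lam *\<^sub>R B (T zs)) = zs" .
    moreover have "B (xs - \<gamma> *\<^sub>R G xs) - lam *\<^sub>R B (T zs) = B xs"
    proof -
      have "xs - \<gamma> *\<^sub>R G xs = xs + lam *\<^sub>R T zs" using fix2 by (simp add: add_eq_0_iff2)
      then show ?thesis by (simp only: linear_add[OF B] linear_scale[OF B] add_diff_cancel_right')
    qed
    ultimately show ?thesis by (simp add: algebra_simps)
  qed
  \<comment> \<open>The distance to the cluster point is monotone and tends to 0 along
    \<open>r\<close>, hence along the whole sequence.\<close>
  have "V xs zs \<longlonglongrightarrow> 0"
  proof -
    have "\<forall>k. 0 \<le> V xs zs k" by (simp add: V0)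
    from decseq_convergent[OF dec[OF fix1 fix2] this]
    obtain c where c: "V xs zs \<longlonglongrightarrow> c" by metis
    have "(\<lambda>k. V xs zs (r k)) \<longlonglongrightarrow> (norm (xs - xs))\<^sup>2 + lam * (norm (zs - zs))\<^sup>2"
      unfolding V_def by (intro tendsto_intros xr zr)
    then show ?thesis using LIMSEQ_unique[OF sub[OF c]] c by simp
  qed
  then have "(\<lambda>k. 1 * (norm (x k - xs))\<^sup>2) \<longlonglongrightarrow> 0"
    by (rule tendsto_sandwich[OF _ _ tendsto_const, rotated 2])
      (use lam in \<open>auto simp: V_def\<close>)
  then have "(\<lambda>k. x k - xs) \<longlonglongrightarrow> 0"
    by (rule LIMSEQ_norm_zero_if_scaled_square) simp
  then have "x \<longlonglongrightarrow> xs" by (simp add: LIM_zero_iff)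
  then show thesis using that fix1 fix2 T_def by blast
qed

section \<open>Optimality conditions and existence of dual solutions\<close>

lemma GDERIV_right_quotient:
  assumes "GDERIV f u :> G"
  shows "((\<lambda>t. (f (u + t *\<^sub>R d) - f u) / t) \<longlongrightarrow> G \<bullet> d) (at_right 0)"
proof -
  have "((\<lambda>t. f (u + t *\<^sub>R d)) has_real_derivative (G \<bullet> d)) (at 0)"
    using assms by (intro GDERIV_along_line) simp
  then show ?thesis
    by (auto simp: DERIV_def intro: tendsto_mono[OF at_le])
qed

lemma Gamma0_gradient_inequality:
  assumes f: "(\<lambda>u. ereal (f u)) \<in> Gamma0" and G: "GDERIV f u :> G"
  shows "f u + G \<bullet> (w - u) \<le> f w"
proof -
  have "(f (u + t *\<^sub>R (w - u)) - f u) / t \<le> f w - f u" if "0 < t" "t < 1" for t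
    using Gamma0_convex_le[OF f refl refl that, of u w] that by (simp add: field_simps)
  then have "\<forall>\<^sub>F t in at_right 0. (f (u + t *\<^sub>R (w - u)) - f u) / t \<le> f w - f u"
    by (auto simp: eventually_at_right[of 0 1] intro!: exI[of _ 1])
  from tendsto_upperbound[OF GDERIV_right_quotient[OF G] this]
  show ?thesis by simp
qed

text \<open>Along the segment from \<open>xs\<close> to \<open>u\<close>, minimality bounds the
  difference quotient of \<open>f\<close> below by the convexity increments of \<open>g\<close> and
  \<open>h\<close>; then \<open>t\<close> tends to 0. Thus \<open>xs\<close> still minimizes once
  \<open>f\<close> is replaced by its linearization.\<close>

lemma arg_min_sum_linearized:
  fixes g :: "'a::euclidean_space \<Rightarrow> ereal" and h :: "'b::euclidean_space \<Rightarrow> ereal"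
  assumes g: "g \<in> Gamma0" and h: "h \<in> Gamma0" and D: "linear D"
    and G: "GDERIV f xs :> G"
    and fin: "g xs = ereal \<alpha>" "h (D xs) = ereal \<eta>"
    and min: "\<And>u. ereal (f xs) + g xs + h (D xs) \<le> ereal (f u) + g u + h (D u)"
    and u: "g u = ereal b" "h (D u) = ereal a"
  shows "\<alpha> + \<eta> \<le> a + b + G \<bullet> (u - xs)"
proof -
  have "- (b - \<alpha> + (a - \<eta>)) \<le> (f (xs + t *\<^sub>R (u - xs)) - f xs) / t" if t: "0 < t" "t < 1" for t
  proof -
    have Dt: "D (xs + t *\<^sub>R (u - xs)) = D xs + t *\<^sub>R (D u - D xs)"
      by (simp add: linear_add[OF D] linear_scale[OF D] linear_diff[OF D])
    obtain b' where b': "g (xs + t *\<^sub>R (u - xs)) = ereal b'" "b' \<le> \<alpha> + t * (b - \<alpha>)"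
      using Gamma0_convex_finite[OF g fin(1) u(1) t] .
    obtain a' where a': "h (D (xs + t *\<^sub>R (u - xs))) = ereal a'" "a' \<le> \<eta> + t * (a - \<eta>)"
      using Gamma0_convex_finite[OF h fin(2) u(2) t] unfolding Dt .
    have "f xs + \<alpha> + \<eta> \<le> f (xs + t *\<^sub>R (u - xs)) + b' + a'"
      using min[of "xs + t *\<^sub>R (u - xs)"] fin a'(1) b'(1) by simp
    then have "- (t * (b - \<alpha> + (a - \<eta>))) \<le> f (xs + t *\<^sub>R (u - xs)) - f xs"
      using a'(2) b'(2) by (simp add: algebra_simps)
    then show ?thesis using t by (simp add: field_simps)
  qed
  then have "\<forall>\<^sub>F t in at_right 0. - (b - \<alpha> + (a - \<eta>)) \<le> (f (xs + t *\<^sub>R (u - xs)) - f xs) / t"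
    by (auto simp: eventually_at_right[of 0 1] intro!: exI[of _ 1])
  from tendsto_lowerbound[OF GDERIV_right_quotient[OF G] this]
  show ?thesis by simp
qed

text \<open>Fenchel-Rockafellar duality by separation. The hyperplane normal \<open>(p, c)\<close>
  has \<open>c > 0\<close> by the qualification condition, and \<open>- p / c\<close> is the dual
  solution: setting \<open>u = xs\<close> gives the inequality for \<open>h\<close>, setting
  \<open>w = D xs\<close> the one for \<open>g\<close>.\<close>

lemma composite_subgradients_exist:
  fixes g :: "'a::euclidean_space \<Rightarrow> ereal" and h :: "'b::euclidean_space \<Rightarrow> ereal"
  assumes g: "g \<in> Gamma0" and h: "h \<in> Gamma0" and D: "linear D"
    and qual: "0 \<in> rel_interior {w - D u | w u. w \<in> effective_domain h \<and> u \<in> effective_domain g}"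
    and fin: "g xs = ereal \<alpha>" "h (D xs) = ereal \<eta>"
    and min: "\<And>u a b. g u = ereal b \<Longrightarrow> h (D u) = ereal a \<Longrightarrow> \<alpha> + \<eta> \<le> a + b + G \<bullet> (u - xs)"
  obtains p where "subgradient h (D xs) p" "subgradient g xs (- G - adjoint D p)"
proof -
  define E where "E = {w - D u | w u. w \<in> effective_domain h \<and> u \<in> effective_domain g}"
  define k where "k b u = b + G \<bullet> (u - xs)" for b u
  \<comment> \<open>The strict epigraph of the linearized problem, shifted by its optimal value and
    perturbed in the constraint \<open>w = D u\<close>. Optimality of \<open>xs\<close> keeps the
    origin out of it.\<close>
  define S where "S = {(w - D u, r) | w u r. \<exists>a b. h w = ereal a \<and> g u = ereal b
      \<and> a + k b u - (\<alpha> + \<eta>) < r}"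
  have S_I: "(w - D u, r) \<in> S" if "h w = ereal a" "g u = ereal b" "a + k b u - (\<alpha> + \<eta>) < r" for w u r a b
    using that unfolding S_def by blast
  have "convex S"
    unfolding convex_alt
  proof (intro ballI allI impI)
    fix s s' :: "'b \<times> real" and t :: real assume s: "s \<in> S" "s' \<in> S" and t01: "0 \<le> t \<and> t \<le> 1"
    show "(1 - t) *\<^sub>R s + t *\<^sub>R s' \<in> S"
    proof (cases "t = 0 \<or> t = 1")
      case False
      then have t: "0 < t" "t < 1" using t01 by auto
      obtain w u r a b where 1: "s = (w - D u, r)" "h w = ereal a" "g u = ereal b"
          "a + k b u - (\<alpha> + \<eta>) < r"
        using s(1) unfolding S_def by blast
      obtain w' u' r' a' b' where 2: "s' = (w' - D u', r')" "h w' = ereal a'" "g u' = ereal b'"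
          "a' + k b' u' - (\<alpha> + \<eta>) < r'"
        using s(2) unfolding S_def by blast
      obtain a'' where a'': "h (w + t *\<^sub>R (w' - w)) = ereal a''" "a'' \<le> a + t * (a' - a)"
        using Gamma0_convex_finite[OF h 1(2) 2(2) t] .
      obtain b'' where b'': "g (u + t *\<^sub>R (u' - u)) = ereal b''" "b'' \<le> b + t * (b' - b)"
        using Gamma0_convex_finite[OF g 1(3) 2(3) t] .
      have "(1 - t) * (a + k b u - (\<alpha> + \<eta>)) + t * (a' + k b' u' - (\<alpha> + \<eta>)) < (1 - t) * r + t * r'"
        using 1(4) 2(4) t by (intro add_strict_mono mult_strict_left_mono) auto
      then have "a'' + k b'' (u + t *\<^sub>R (u' - u)) - (\<alpha> + \<eta>) < (1 - t) * r + t * r'"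
        using a''(2) b''(2) by (simp add: k_def inner_simps algebra_simps)
      from S_I[OF a''(1) b''(1) this] show ?thesis
        by (simp add: 1(1) 2(1) linear_add[OF D] linear_scale[OF D] linear_diff[OF D] algebra_simps)
    qed (use s in auto)
  qed
  moreover have one: "(0, 1) \<in> S"
    using S_I[OF fin(2) fin(1), of 1] by (simp add: k_def)
  moreover have "0 \<notin> S"
  proof
    assume "0 \<in> S"
    then obtain w u r a b where "w = D u" "r = 0" "h w = ereal a" "g u = ereal b" "a + k b u - (\<alpha> + \<eta>) < r"
      unfolding S_def zero_prod_def by auto
    then show False using min[of u b a] by (simp add: k_def)
  qed
  \<comment> \<open>The normal is taken in the span of \<open>S\<close>, so its first component lies
    in the span of the differences \<open>w - D u\<close>.\<close>
  ultimately obtain s where s: "s \<in> span S" "s \<noteq> 0" "\<And>r. r \<in> S \<Longrightarrow> 0 \<le> s \<bullet> r"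
    using separating_hyperplane_set_0_inspan[of S] by blast
  obtain p c where pc: "s = (p, c)" by (cases s)
  have c0: "0 \<le> c" using s(3)[OF one] by (simp add: pc)
  have sep: "0 \<le> p \<bullet> (w - D u) + c * (a + k b u - (\<alpha> + \<eta>))" if "h w = ereal a" "g u = ereal b" for w u a b
  proof (rule nonneg_if_affine_nonneg[of _ c])
    fix t :: real assume "0 < t"
    from s(3)[OF S_I[OF that, of "a + k b u - (\<alpha> + \<eta>) + t"]] this
    show "0 \<le> p \<bullet> (w - D u) + c * (a + k b u - (\<alpha> + \<eta>)) + t * c"
      by (simp add: pc algebra_simps)
  qed
  \<comment> \<open>A vertical hyperplane (\<open>c = 0\<close>) would have all of \<open>E\<close> on one side; since \<open>p \<in> span E\<close>, the relative
    interior condition puts a negative multiple of \<open>p\<close> into \<open>E\<close>.\<close>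
  have "c \<noteq> 0"
  proof
    assume "c = 0"
    have fstS: "fst ` S \<subseteq> E"
    proof
      fix d assume "d \<in> fst ` S"
      then obtain w u a b where "d = w - D u" "h w = ereal a" "g u = ereal b"
        unfolding S_def by auto
      then show "d \<in> E"
        unfolding E_def effective_domain_def by (intro CollectI exI[of _ w] exI[of _ u]) simp
    qed
    have "p \<in> fst ` span S" using s(1) pc by (metis fst_conv image_eqI)
    then have pE: "p \<in> span E"
      using linear_span_image[OF linear_fst, of S] span_mono[OF fstS] by auto
    have "0 \<in> E" using qual rel_interior_subset E_def by blast
    obtain e where e: "e > 0" "ball 0 e \<inter> affine hull E \<subseteq> E"
      using qual unfolding E_def[symmetric] mem_rel_interior_ball by blast
    have p0: "p \<noteq> 0" using s(2) pc \<open>c = 0\<close> by (simp add: zero_prod_def)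
    \<comment> \<open>Places \<open>- d *\<^sub>R p\<close> at distance \<open>e / 2\<close> from
      the origin, inside the ball.\<close>
    define d where "d = e / (2 * norm p)"
    have d: "0 < d" using e p0 by (simp add: d_def)
    have "- d *\<^sub>R p \<in> affine hull E"
      using pE \<open>0 \<in> E\<close> span_scale[of p E "-d"] by (simp add: affine_hull_span_0 hull_inc)
    moreover have "- d *\<^sub>R p \<in> ball 0 e"
      using e p0 by (simp add: d_def)
    ultimately obtain w u where wu: "- d *\<^sub>R p = w - D u" "h w < \<infinity>" "g u < \<infinity>"
      using e(2) unfolding E_def effective_domain_def by blast
    obtain a b where "h w = ereal a" "g u = ereal b"
      using wu(2,3) by (cases rule: Gamma0_dom_cases[OF h, of w]; cases rule: Gamma0_dom_cases[OF g, of u]) auto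
    from sep[OF this] have "0 \<le> - d * (p \<bullet> p)"
      using \<open>c = 0\<close> by (simp add: wu(1)[symmetric])
    then have "p \<bullet> p \<le> 0" using d by (simp add: mult_le_0_iff)
    then show False using p0 inner_gt_zero_iff[of p] by linarith
  qed
  with c0 have c: "0 < c" by simp
  define P where "P = - (1 / c) *\<^sub>R p"
  have p: "p = - c *\<^sub>R P" using c by (simp add: P_def)
  have "subgradient h (D xs) P"
    unfolding subgradient_def
  proof (intro conjI allI)
    fix w
    show "h (D xs) + ereal (P \<bullet> (w - D xs)) \<le> h w"
    proof (cases rule: Gamma0_dom_cases[OF h, of w])
      case (2 a)
      from sep[OF this fin(1)] have "0 \<le> c * (a - \<eta> - P \<bullet> (w - D xs))"
        by (simp add: p k_def algebra_simps)
      then show ?thesis using c fin 2 by (simp add: zero_le_mult_iff)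
    qed simp
  qed (simp add: fin)
  moreover have "subgradient g xs (- G - adjoint D P)"
    unfolding subgradient_def
  proof (intro conjI allI)
    fix u
    show "g xs + ereal ((- G - adjoint D P) \<bullet> (u - xs)) \<le> g u"
    proof (cases rule: Gamma0_dom_cases[OF g, of u])
      case (2 b)
      have "adjoint D P \<bullet> (u - xs) = P \<bullet> (D u - D xs)"
        by (simp add: adjoint_clauses[OF D] linear_diff[OF D])
      moreover from sep[OF fin(2) 2] have "0 \<le> c * (b - \<alpha> + G \<bullet> (u - xs) + P \<bullet> (D u - D xs))"
        by (simp add: p k_def inner_diff_right algebra_simps)
      ultimately show ?thesis
        using c fin 2 by (simp add: zero_le_mult_iff inner_diff_left)
    qed simp
  qed (simp add: fin)
  ultimately show thesis using that by blast
qed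

text \<open>Add the gradient inequality of \<open>f\<close> and the two subgradient inequalities;
  the linear terms cancel because the subgradients sum to zero through
  \<open>adjoint D\<close>.\<close>

lemma arg_min_if_subgradients:
  fixes g :: "'a::euclidean_space \<Rightarrow> ereal" and h :: "'b::euclidean_space \<Rightarrow> ereal"
  assumes f: "(\<lambda>u. ereal (f u)) \<in> Gamma0" and G: "GDERIV f xs :> G" and D: "linear D"
    and h: "subgradient h (D xs) p" and g: "subgradient g xs (- G - adjoint D p)"
  shows "ereal (f xs) + g xs + h (D xs) \<le> ereal (f u) + g u + h (D u)"
proof -
  obtain \<alpha> \<eta> where fin: "g xs = ereal \<alpha>" "h (D xs) = ereal \<eta>"
    using g h by (auto simp: subgradient_def)
  have "adjoint D p \<bullet> (u - xs) = p \<bullet> (D u - D xs)"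
    by (simp add: adjoint_clauses[OF D] linear_diff[OF D])
  then have "f xs + \<alpha> + \<eta> \<le> f u + (\<alpha> + (- G - adjoint D p) \<bullet> (u - xs)) + (\<eta> + p \<bullet> (D u - D xs))"
    using Gamma0_gradient_inequality[OF f G, of u] by (simp add: inner_diff_left)
  then have "ereal (f xs) + g xs + h (D xs)
      \<le> ereal (f u) + (g xs + ereal ((- G - adjoint D p) \<bullet> (u - xs))) + (h (D xs) + ereal (p \<bullet> (D u - D xs)))"
    by (simp add: fin)
  also have "\<dots> \<le> ereal (f u) + g u + h (D u)"
    using g h by (intro add_mono) (auto simp: subgradient_def)
  finally show ?thesis .
qed

section \<open>The norm of the stacked operator\<close>

lemma lambda_max_nonneg:
  fixes D :: "'a::euclidean_space \<Rightarrow> 'b::euclidean_space"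
  assumes "linear D"
  shows "0 \<le> lambda_max (D \<circ> adjoint D)"
proof -
  obtain e :: 'b where "e \<in> Basis" using nonempty_Basis by blast
  then show ?thesis
    using order_trans[OF zero_le_power2 norm_adjoint_le_lambda_max[OF assms, of e]] by simp
qed

text \<open>Bounds the adjoint of \<open>u \<mapsto> (D u, u)\<close>. After the triangle inequality
  this is Cauchy-Schwarz against the vector \<open>(sqrt l, 1)\<close>, whose defect is the square
  of \<open>norm p - sqrt l * norm q\<close>.\<close>

lemma norm_adjoint_Pair_le:
  fixes D :: "'a::euclidean_space \<Rightarrow> 'b::euclidean_space"
  assumes "linear D"
  shows "(norm (adjoint D p + q))\<^sup>2 \<le> (lambda_max (D \<circ> adjoint D) + 1) * (norm (p, q))\<^sup>2"
proof -
  define l where "l = lambda_max (D \<circ> adjoint D)"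
  have le: "(norm (adjoint D w))\<^sup>2 \<le> l * (norm w)\<^sup>2" for w
    unfolding l_def by (rule norm_adjoint_le_lambda_max[OF assms])
  have "norm (adjoint D p) \<le> sqrt (l * (norm p)\<^sup>2)"
    using le by (rule real_le_rsqrt)
  then have n: "norm (adjoint D p) \<le> sqrt l * norm p"
    by (simp add: real_sqrt_mult)
  have "norm (adjoint D p + q) \<le> sqrt l * norm p + norm q"
    using norm_triangle_ineq[of "adjoint D p" q] n by linarith
  then have "(norm (adjoint D p + q))\<^sup>2 \<le> (sqrt l * norm p + norm q)\<^sup>2"
    by (rule power_mono) simp
  also have "\<dots> \<le> (l + 1) * ((norm p)\<^sup>2 + (norm q)\<^sup>2)"
  proof -
    have "(l + 1) * ((norm p)\<^sup>2 + (norm q)\<^sup>2) - (sqrt l * norm p + norm q)\<^sup>2 = (norm p - sqrt l * norm q)\<^sup>2"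
    proof -
      define s where "s = sqrt l"
      have s: "l = s * s" using lambda_max_nonneg[OF assms] by (simp add: s_def l_def)
      show ?thesis unfolding s_def[symmetric] s by (simp add: power2_eq_square algebra_simps)
    qed
    then show ?thesis using zero_le_power2[of "norm p - sqrt l * norm q"] by linarith
  qed
  finally show ?thesis
    by (simp add: l_def norm_Pair)
qed

section \<open>Reduction of the iteration to the abstract scheme\<close>

theorem theorem3p2:
  fixes f :: "'a::euclidean_space \<Rightarrow> real"
    and g :: "'a \<Rightarrow> ereal"
    and h :: "'b::euclidean_space \<Rightarrow> ereal"
    and D :: "'a \<Rightarrow> 'b"
    and gradf :: "'a \<Rightarrow> 'a"
    and \<beta> \<gamma> lam :: real
    and x xhalf y :: "nat \<Rightarrow> 'a"
    and v :: "nat \<Rightarrow> 'b"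
  assumes f_Gamma0: "(\<lambda>u. ereal (f u)) \<in> Gamma0"
    and g_Gamma0: "g \<in> Gamma0"
    and h_Gamma0: "h \<in> Gamma0"
    and D_linear: "linear D"
    and D_inj: "inj D"
    and beta_pos: "0 < \<beta>"
    and f_gradient: "\<And>u. GDERIV f u :> gradf u"
    and gradient_lipschitz: "(1 / \<beta>)-lipschitz_on UNIV gradf"
    and attained: "\<exists>u. is_arg_min (\<lambda>u. ereal (f u) + g u + (h \<circ> D) u) (\<lambda>_. True) u"
    and qualification:
      "0 \<in> rel_interior {w - D u | w u. w \<in> effective_domain h \<and> u \<in> effective_domain g}"
    and gamma: "0 < \<gamma>" "\<gamma> < 2 * \<beta>"
    and lam: "0 < lam" "lam \<le> 1 / (lambda_max (D \<circ> adjoint D) + 1)"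
    and xhalf_step: "\<And>k. xhalf k = x k - \<gamma> *\<^sub>R gradf (x k)"
    and v_step: "\<And>k. v (Suc k) =
      (id - prox (\<lambda>w. ereal (\<gamma> / lam) * h w))
        (D (xhalf k) + (v k - lam *\<^sub>R D (adjoint D (v k))) - lam *\<^sub>R D (y k))"
    and y_step: "\<And>k. y (Suc k) =
      (id - prox (\<lambda>u. ereal (\<gamma> / lam) * g u))
        (xhalf k + (1 - lam) *\<^sub>R y k - lam *\<^sub>R adjoint D (v k))"
    and x_step: "\<And>k. x (Suc k) =
      xhalf k - lam *\<^sub>R adjoint D (v (Suc k)) - lam *\<^sub>R y (Suc k)"
  shows "\<exists>xs. is_arg_min (\<lambda>u. ereal (f u) + g u + (h \<circ> D) u) (\<lambda>_. True) xs
    \<and> x \<longlonglongrightarrow> xs"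
proof -
  define L where "L = lambda_max (D \<circ> adjoint D)"
  define B where "B u = (D u, u)" for u
  define Q where "Q p = ((id - prox (\<lambda>w. ereal (\<gamma> / lam) * h w)) (fst p),
    (id - prox (\<lambda>u. ereal (\<gamma> / lam) * g u)) (snd p))" for p
  define z where "z k = (v k, y k)" for k
  define solves where "solves u \<longleftrightarrow> is_arg_min (\<lambda>u. ereal (f u) + g u + (h \<circ> D) u) (\<lambda>_. True) u" for u
  have solves_iff: "solves u \<longleftrightarrow> (\<forall>w. ereal (f u) + g u + h (D u) \<le> ereal (f w) + g w + h (D w))" for u
    by (simp add: solves_def is_arg_min_linorder)
  have c: "0 < \<gamma> / lam" using gamma lam by simp
  have B_lin: "linear B"
    using D_linear unfolding B_def by (simp add: linear_iff)
  have B_adj: "adjoint B = (\<lambda>p. adjoint D (fst p) + snd p)"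
    by (rule adjoint_unique)
      (auto simp: B_def adjoint_clauses[OF D_linear] inner_commute inner_add_left inner_add_right)
  have fixed_iff: "Q (B u + (\<gamma> / lam) *\<^sub>R (p, q)) = (\<gamma> / lam) *\<^sub>R (p, q)
      \<longleftrightarrow> subgradient h (D u) p \<and> subgradient g u q" for u p q
    using id_minus_prox_scaled_fixed_iff[OF h_Gamma0 c, of "D u" p]
      id_minus_prox_scaled_fixed_iff[OF g_Gamma0 c, of u q]
    by (simp add: Q_def B_def)
  have balance_iff: "\<gamma> *\<^sub>R gradf u + lam *\<^sub>R adjoint B ((\<gamma> / lam) *\<^sub>R (p, q)) = 0
      \<longleftrightarrow> q = - gradf u - adjoint D p" for u p q
  proof -
    have "lam *\<^sub>R adjoint B ((\<gamma> / lam) *\<^sub>R (p, q)) = \<gamma> *\<^sub>R (adjoint D p + q)"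
      using lam unfolding linear_scale[OF adjoint_linear[OF B_lin]] by (simp add: B_adj)
    then have "\<gamma> *\<^sub>R gradf u + lam *\<^sub>R adjoint B ((\<gamma> / lam) *\<^sub>R (p, q)) = \<gamma> *\<^sub>R (gradf u + adjoint D p + q)"
      by (simp add: algebra_simps)
    then have "\<gamma> *\<^sub>R gradf u + lam *\<^sub>R adjoint B ((\<gamma> / lam) *\<^sub>R (p, q)) = 0
        \<longleftrightarrow> gradf u + adjoint D p + q = 0"
      using gamma(1) by simp
    then show ?thesis
      by (simp add: add_eq_0_iff)
  qed
  obtain u0 where u0: "solves u0" using attained solves_def by blast
  \<comment> \<open>The qualification condition puts 0 into the set of differences, so some
    \<open>u\<close> in the domain of \<open>g\<close> has \<open>D u\<close> in the domain of
    \<open>h\<close>. The objective is finite there, hence also at the minimizer.\<close>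
  obtain \<alpha> \<eta> where fin: "g u0 = ereal \<alpha>" "h (D u0) = ereal \<eta>"
  proof -
    have "0 \<in> {w - D u | w u. w \<in> effective_domain h \<and> u \<in> effective_domain g}"
      using qualification rel_interior_subset by blast
    then obtain u where "h (D u) < \<infinity>" "g u < \<infinity>"
      by (auto simp: effective_domain_def)
    then have "ereal (f u) + g u + h (D u) < \<infinity>"
      by simp
    then have "ereal (f u0) + g u0 + h (D u0) < \<infinity>"
      using u0 solves_iff le_less_trans by blast
    then show thesis
      using that by (cases rule: Gamma0_dom_cases[OF g_Gamma0, of u0];
          cases rule: Gamma0_dom_cases[OF h_Gamma0, of "D u0"]) auto
  qed
  obtain p0 where p0: "subgradient h (D u0) p0" "subgradient g u0 (- gradf u0 - adjoint D p0)"
  proof (rule composite_subgradients_exist[OF g_Gamma0 h_Gamma0 D_linear qualification fin])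
    fix u a b assume "g u = ereal b" "h (D u) = ereal a"
    then show "\<alpha> + \<eta> \<le> a + b + gradf u0 \<bullet> (u - u0)"
      using u0 by (intro arg_min_sum_linearized[OF g_Gamma0 h_Gamma0 D_linear f_gradient fin])
        (auto simp: solves_iff)
  qed
  have coco: "\<beta> * (norm (gradf u - gradf w))\<^sup>2 \<le> (gradf u - gradf w) \<bullet> (u - w)" for u w
    using gradient_cocoercive[OF f_gradient gradient_lipschitz _ Gamma0_gradient_inequality[OF f_Gamma0 f_gradient]]
      beta_pos by simp
  have firm: "(norm (Q p - Q q))\<^sup>2 \<le> (Q p - Q q) \<bullet> (p - q)" for p q
    using id_minus_prox_firmly_nonexpansive[OF Gamma0_scale[OF h_Gamma0 c], of "fst p" "fst q"]
      id_minus_prox_firmly_nonexpansive[OF Gamma0_scale[OF g_Gamma0 c], of "snd p" "snd q"]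
    by (simp add: Q_def norm_Pair inner_prod_def)
  have psd: "lam * (norm (adjoint B p))\<^sup>2 \<le> (norm p)\<^sup>2" for p
  proof -
    have "lam * (L + 1) \<le> 1"
      using lam(2) lambda_max_nonneg[OF D_linear] by (simp add: L_def field_simps)
    then have "lam * (L + 1) * (norm p)\<^sup>2 \<le> 1 * (norm p)\<^sup>2"
      by (rule mult_right_mono) simp
    moreover have "lam * (norm (adjoint B p))\<^sup>2 \<le> lam * ((L + 1) * (norm p)\<^sup>2)"
      using norm_adjoint_Pair_le[OF D_linear, of "fst p" "snd p"] lam(1)
      by (intro mult_left_mono) (simp_all add: B_adj L_def)
    ultimately show ?thesis by simp
  qed
  have z_step: "z (Suc k) = Q (B (x k - \<gamma> *\<^sub>R gradf (x k)) + z k - lam *\<^sub>R B (adjoint B (z k)))" for k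
  proof -
    \<comment> \<open>With \<open>s = adjoint D (v k) + y k\<close>, the subtracted term is
      \<open>lam *\<^sub>R (D s, s)\<close>; its second component produces the factor
      \<open>1 - lam\<close> on \<open>y k\<close>.\<close>
    have "B (xhalf k) + z k - lam *\<^sub>R B (adjoint B (z k))
        = (D (xhalf k) + (v k - lam *\<^sub>R D (adjoint D (v k))) - lam *\<^sub>R D (y k),
           xhalf k + (1 - lam) *\<^sub>R y k - lam *\<^sub>R adjoint D (v k))"
      by (simp add: B_def z_def B_adj linear_add[OF D_linear] algebra_simps)
    then show ?thesis
      using v_step[of k] y_step[of k] by (simp add: xhalf_step[symmetric] Q_def) (simp add: z_def)
  qed
  have x_step': "x (Suc k) = x k - \<gamma> *\<^sub>R gradf (x k) - lam *\<^sub>R adjoint B (z (Suc k))" for k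
    by (simp add: x_step xhalf_step B_adj z_def algebra_simps)
  have fixed0: "Q (B u0 + (\<gamma> / lam) *\<^sub>R (p0, - gradf u0 - adjoint D p0))
      = (\<gamma> / lam) *\<^sub>R (p0, - gradf u0 - adjoint D p0)"
    and balance0: "\<gamma> *\<^sub>R gradf u0 + lam *\<^sub>R adjoint B ((\<gamma> / lam) *\<^sub>R (p0, - gradf u0 - adjoint D p0)) = 0"
    unfolding fixed_iff balance_iff using p0 by simp_all
  obtain xs zs where xs: "Q (B xs + zs) = zs" "\<gamma> *\<^sub>R gradf xs + lam *\<^sub>R adjoint B zs = 0" "x \<longlonglongrightarrow> xs"
    by (rule primal_dual_fixed_point_convergence[where G = gradf and Q = Q and x = x and z = z,
          OF B_lin beta_pos coco firm gamma lam(1) psd z_step x_step' fixed0 balance0])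
  \<comment> \<open>Undoes the scaling by \<open>\<gamma> / lam\<close>, so that the dual limit is
    read as a pair of subgradients.\<close>
  define p q where "p = (lam / \<gamma>) *\<^sub>R fst zs" and "q = (lam / \<gamma>) *\<^sub>R snd zs"
  have zs: "zs = (\<gamma> / lam) *\<^sub>R (p, q)"
    using gamma lam by (simp add: p_def q_def)
  have "subgradient h (D xs) p" "subgradient g xs q" "q = - gradf xs - adjoint D p"
    using xs(1,2) unfolding zs fixed_iff balance_iff by auto
  then have "solves xs"
    unfolding solves_iff
    using arg_min_if_subgradients[OF f_Gamma0 f_gradient D_linear] by blast
  then show ?thesis using xs(3) solves_def by blast
qed

end
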